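(* Let $\Omega$ be a $\mathcal C^1$-smooth, bounded, strictly geometrically convex domain in $\mathbb C^2$. Let $\sigma:\mathbb C\to\mathbb R$ be a $\mathcal C^1$-smooth nonnegative function on the complex plane with $\sigma(0)=0$, let $D:=\{(w,z)\in\mathbb C^2:\ \operatorname{Re} w+\sigma(z)<0\}$, and let $\psi:\Omega\to D$ be a biholomorphism. Then there exists a point $a_\infty\in\partial\Omega$ such that $\lim_{t\to+\infty}\psi^{-1}(w\pm it,z)=a_\infty$ (for both choices of sign) for every $(w,z)\in D$.
   Context: A bounded domain $\Omega\subset\mathbb C^2$ is strictly geometrically convex if it is convex (as a subset of $\mathbb R^4$) and its boundary contains no nontrivial line segment; $\mathcal C^1$-smooth means that the boundary $\partial\Omega$ is of class $\mathcal C^1$. *)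

theory Defs
  imports "HOL-Analysis.Analysis"
begin

text \<open>The space $C^2$ is the type \<open>complex \<times> complex\<close>, whose library norm is the
  Euclidean norm of $R^4$. The type carries only a real vector space structure, so
  multiplication by complex scalars is defined here.\<close>

definition cscale :: "complex \<Rightarrow> complex \<times> complex \<Rightarrow> complex \<times> complex" where
  "cscale c p = (c * fst p, c * snd p)"

text \<open>The following three definitions are meant for open sets \<open>U\<close> (and \<open>V\<close>).\<close>

definition C1_on :: "('a::real_normed_vector \<Rightarrow> 'b::real_normed_vector) \<Rightarrow> 'a set \<Rightarrow> bool" where
  "C1_on f U \<longleftrightarrow>
     (\<exists>f' :: 'a \<Rightarrow> 'a \<Rightarrow>\<^sub>L 'b.
        (\<forall>x\<in>U. (f has_derivative blinfun_apply (f' x)) (at x)) \<and> continuous_on U f')"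

definition holomorphic2_on ::
    "(complex \<times> complex \<Rightarrow> complex \<times> complex) \<Rightarrow> (complex \<times> complex) set \<Rightarrow> bool" where
  "holomorphic2_on f U \<longleftrightarrow>
     (\<forall>p\<in>U. \<exists>L. (f has_derivative L) (at p) \<and> (\<forall>c v. L (cscale c v) = cscale c (L v)))"

definition biholomorphism ::
    "(complex \<times> complex \<Rightarrow> complex \<times> complex) \<Rightarrow>
     (complex \<times> complex) set \<Rightarrow> (complex \<times> complex) set \<Rightarrow> bool" where
  "biholomorphism f U V \<longleftrightarrow>
     bij_betw f U V \<and> holomorphic2_on f U \<and> holomorphic2_on (inv_into U f) V"

definition is_domain :: "'a::topological_space set \<Rightarrow> bool" where
  "is_domain U \<longleftrightarrow> open U \<and> connected U \<and> U \<noteq> {}"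

text \<open>Near each boundary point the set is a sublevel set \<open>r < 0\<close> of a $C^1$
  local defining function with nowhere vanishing differential.\<close>

definition C1_boundary :: "'a::real_normed_vector set \<Rightarrow> bool" where
  "C1_boundary U \<longleftrightarrow>
     (\<forall>p\<in>frontier U. \<exists>N (r :: 'a \<Rightarrow> real).
        open N \<and> p \<in> N \<and> C1_on r N \<and>
        (\<forall>x\<in>N. \<not> (r has_derivative (\<lambda>v. 0)) (at x)) \<and>
        U \<inter> N = {x \<in> N. r x < 0} \<and>
        frontier U \<inter> N = {x \<in> N. r x = 0})"

definition strictly_geometrically_convex :: "'a::real_normed_vector set \<Rightarrow> bool" where
  "strictly_geometrically_convex U \<longleftrightarrow>
     convex U \<and> (\<forall>a b. a \<noteq> b \<longrightarrow> \<not> closed_segment a b \<subseteq> frontier U)"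

end

theory Submission
  imports Defs "HOL-Complex_Analysis.Conformal_Mappings"
begin

text \<open>Let \<open>f\<close> be the inverse of \<open>\<psi>\<close>, let \<open>x t = f (-1 + \<i> t, 0)\<close>, and let \<open>\<pi> = fst \<circ> \<psi>\<close>, which is a
  left inverse of \<open>z \<mapsto> f (z, 0)\<close> on the left half-plane because \<open>\<sigma> 0 = 0\<close>. Every limit point \<open>a\<close>
  of \<open>x\<close> at infinity lies on the boundary, and a Julia-type estimate gives
  \<open>Re (\<pi> ((f (z, 0) + a) / 2)) \<le> Re z\<close> for all \<open>z\<close> in the half-plane. Let \<open>b \<noteq> a\<close> be another
  limit point, along times \<open>s n\<close>. By Harnack's inequality for a supporting functional at \<open>b\<close>, also
  \<open>f (-u + \<i> s n, 0)\<close> tends to \<open>b\<close> for every \<open>u > 0\<close>. Since \<open>(a + b) / 2\<close> is an interior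
  point by strict convexity, passing to the limit in the estimate at \<open>z = -u + \<i> s n\<close> gives
  \<open>Re (\<pi> ((a + b) / 2)) \<le> -u\<close> for every \<open>u > 0\<close>, which is absurd. So \<open>x\<close> has a single limit,
  the same at both ends, and Harnack's inequality carries it to all points of \<open>D\<close>.\<close>

section \<open>Schwarz, Harnack and Schwarz-Pick inequalities for half-planes\<close>

text \<open>The quotient \<open>(z - a) / (z + cnj a)\<close> is the Cayley transform sending
  \<open>a\<close> to 0. This identity shows that its modulus is below 1 when
  \<open>Re z * Re a\<close> is positive, and it trades inequalities between moduli for inequalities
  between real parts.\<close>

lemma half_plane_norm_diff:
  "(cmod (z - a))\<^sup>2 = (cmod (z + cnj a))\<^sup>2 - 4 * Re z * Re a"
  unfolding cmod_power2 by (simp add: power2_eq_square algebra_simps)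

lemma half_plane_plus_cnj_neq_0:
  assumes "0 < Re z" "0 < Re a"
  shows "z + cnj a \<noteq> 0"
  using assms by (auto simp: complex_eq_iff)

text \<open>The Cayley transform centred at \<open>F 0\<close> carries the right half-plane into the
  unit disc and \<open>F 0\<close> to 0, so the classical Schwarz lemma applies to the composition
  \<open>G\<close>.\<close>

lemma Schwarz_Lemma_half_plane:
  assumes "F holomorphic_on ball 0 1" and "\<And>z. cmod z < 1 \<Longrightarrow> 0 < Re (F z)" and "cmod z < 1"
  shows "cmod (F z - F 0) \<le> cmod z * cmod (F z + cnj (F 0))"
proof -
  define G where "G z = (F z - F 0) / (F z + cnj (F 0))" for z
  have nz: "F z + cnj (F 0) \<noteq> 0" if "cmod z < 1" for z
    using assms(2)[OF that] assms(2)[of 0] by (intro half_plane_plus_cnj_neq_0) auto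
  have "G holomorphic_on ball 0 1"
    unfolding G_def using nz by (intro holomorphic_intros assms) auto
  moreover have "cmod (G z) < 1" if "cmod z < 1" for z
  proof -
    have "0 < Re (F z) * Re (F 0)"
      using assms(2)[OF that] assms(2)[of 0] by simp
    then have "(cmod (F z - F 0))\<^sup>2 < (cmod (F z + cnj (F 0)))\<^sup>2"
      unfolding half_plane_norm_diff by (simp add: mult.commute)
    then have "cmod (F z - F 0) < cmod (F z + cnj (F 0))"
      by (simp add: power2_less_imp_less)
    then show ?thesis
      using nz[OF that] by (simp add: G_def norm_divide)
  qed
  ultimately have "cmod (G z) \<le> cmod z"
    using Schwarz_Lemma(1)[of G z] assms(3) by (simp add: G_def)
  then show ?thesis
    using nz[OF assms(3)] by (simp add: G_def norm_divide divide_le_eq)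
qed

text \<open>With \<open>x\<close>, \<open>y\<close> the real parts of \<open>F z\<close>,
  \<open>F 0\<close>, squaring the Schwarz estimate at radius 1/2 gives 3 \<open>N\<close>^2 \<le>
  16 \<open>x\<close> \<open>y\<close>, and \<open>x\<close> \<le> \<open>N\<close> then yields
  \<open>x\<close> \<le> (16/3) \<open>y\<close>. The 6 is this constant rounded up; the sharp one
  is 3.\<close>

lemma Harnack_disc:
  assumes "F holomorphic_on ball 0 1" and "\<And>z. cmod z < 1 \<Longrightarrow> 0 < Re (F z)" and "cmod z \<le> 1/2"
  shows "Re (F z) \<le> 6 * Re (F 0)"
proof -
  have z: "cmod z < 1" using assms(3) by simp
  define x y where "x = Re (F z)" and "y = Re (F 0)"
  have pos: "0 < x" "0 < y"
    using assms(2)[OF z] assms(2)[of 0] by (auto simp: x_def y_def)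
  define N where "N = cmod (F z + cnj (F 0))"
  have "cmod (F z - F 0) \<le> cmod z * N"
    using Schwarz_Lemma_half_plane[OF assms(1,2) z] by (simp add: N_def)
  also have "\<dots> \<le> (1/2) * N"
    using assms(3) by (intro mult_right_mono) (auto simp: N_def)
  finally have "(cmod (F z - F 0))\<^sup>2 \<le> ((1/2) * N)\<^sup>2"
    by (intro power_mono) auto
  then have "N\<^sup>2 - 4 * x * y \<le> N\<^sup>2 / 4"
    unfolding half_plane_norm_diff N_def[symmetric] x_def[symmetric] y_def[symmetric]
    by (simp add: power2_eq_square)
  moreover have "x\<^sup>2 \<le> N\<^sup>2"
  proof (rule power_mono)
    have "x \<le> Re (F z + cnj (F 0))" using pos by (simp add: x_def y_def)
    also have "\<dots> \<le> N" unfolding N_def by (rule complex_Re_le_cmod)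
    finally show "x \<le> N" .
  qed (use pos in simp)
  ultimately have "3 * x * x \<le> 16 * y * x"
    by (simp add: power2_eq_square algebra_simps)
  then have "3 * x \<le> 16 * y" using pos by simp
  then show ?thesis using pos by (simp add: x_def y_def)
qed

text \<open>Invariance of the discs about the fixed point \<open>a\<close>, in a form that survives
  the limit in which \<open>a\<close> runs off to infinity.\<close>

lemma Schwarz_Pick_fixed_point:
  assumes hol: "\<Phi> holomorphic_on {z. Re z < 0}" and maps: "\<And>z. Re z < 0 \<Longrightarrow> Re (\<Phi> z) < 0"
    and fixed: "\<Phi> a = a" and a: "Re a < 0" and z: "Re z < 0"
  shows "Re (\<Phi> z) * (cmod (z + cnj a))\<^sup>2 \<le> Re z * (cmod (\<Phi> z + cnj a))\<^sup>2"
proof -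
  \<comment> \<open>\<open>m\<close> is the inverse Cayley transform: it maps the disc into the left
    half-plane with \<open>m 0 = a\<close>. The sign in \<open>F\<close> moves the values of \<Phi>
    to the right half-plane.\<close>
  define m where "m w = (a + w * cnj a) / (1 - w)" for w
  define F where "F w = - \<Phi> (m w)" for w
  have m: "Re (m w) < 0" if "cmod w < 1" for w
  proof -
    have w: "w \<noteq> 1" using that by auto
    have "m w = (a + w * cnj a) * cnj (1 - w) / (cmod (1 - w))\<^sup>2"
      unfolding m_def using w by (metis complex_div_cnj)
    then have "Re (m w) = Re ((a + w * cnj a) * cnj (1 - w)) / (cmod (1 - w))\<^sup>2"
      by (metis Re_divide_of_real of_real_power)
    also have "Re ((a + w * cnj a) * cnj (1 - w)) = Re a * (1 - (cmod w)\<^sup>2)"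
      unfolding cmod_power2 by (simp add: power2_eq_square algebra_simps)
    also have "Re a * (1 - (cmod w)\<^sup>2) / (cmod (1 - w))\<^sup>2 < 0"
      using a w that by (intro divide_neg_pos mult_neg_pos) (auto simp: power_less_one_iff abs_square_less_1)
    finally show ?thesis .
  qed
  have holF: "F holomorphic_on ball 0 1"
  proof -
    have "m holomorphic_on ball 0 1"
      unfolding m_def by (intro holomorphic_intros) auto
    then have "(\<Phi> \<circ> m) holomorphic_on ball 0 1"
      by (rule holomorphic_on_compose_gen[OF _ hol]) (use m in auto)
    then show ?thesis
      unfolding F_def comp_def by (rule holomorphic_on_minus)
  qed
  define w where "w = (z - a) / (z + cnj a)"
  have nz: "z + cnj a \<noteq> 0" using z a by (auto simp: complex_eq_iff)
  have w1: "1 - w = (a + cnj a) / (z + cnj a)" using nz by (simp add: w_def field_simps)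
  have "a + cnj a \<noteq> 0" using a by (auto simp: complex_eq_iff)
  moreover have "a + w * cnj a = z * (a + cnj a) / (z + cnj a)" using nz by (simp add: w_def field_simps)
  ultimately have mw: "m w = z" using nz by (simp add: m_def w1)
  have m0: "m 0 = a" by (simp add: m_def)
  have pos: "0 < Re z * Re a" using z a by (simp add: mult_neg_neg)
  then have "(cmod (z - a))\<^sup>2 < (cmod (z + cnj a))\<^sup>2"
    unfolding half_plane_norm_diff by (simp add: mult.commute)
  then have "cmod (z - a) < cmod (z + cnj a)" by (simp add: power2_less_imp_less)
  then have "cmod w < 1" using nz by (simp add: w_def norm_divide)
  then have "cmod (F w - F 0) \<le> cmod w * cmod (F w + cnj (F 0))"
    by (intro Schwarz_Lemma_half_plane holF) (use maps m in \<open>auto simp: F_def\<close>)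
  moreover have "F w - F 0 = - (\<Phi> z - a)" "F w + cnj (F 0) = - (\<Phi> z + cnj a)"
    by (auto simp: F_def mw m0 fixed)
  ultimately have "cmod (\<Phi> z - a) \<le> cmod w * cmod (\<Phi> z + cnj a)"
    by (metis norm_minus_cancel)
  then have "cmod (\<Phi> z - a) * cmod (z + cnj a) \<le> cmod (z - a) * cmod (\<Phi> z + cnj a)"
    using nz by (simp add: w_def norm_divide field_simps)
  \<comment> \<open>After squaring and expanding with \<open>half_plane_norm_diff\<close>, the
    product of the two squared moduli with \<open>cnj a\<close> cancels. Dividing by the negative
    number \<open>4 * Re a\<close> then reverses the inequality.\<close>
  then have "(cmod (\<Phi> z - a) * cmod (z + cnj a))\<^sup>2 \<le> (cmod (z - a) * cmod (\<Phi> z + cnj a))\<^sup>2"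
    by (intro power_mono) auto
  then have "4 * Re z * Re a * (cmod (\<Phi> z + cnj a))\<^sup>2 \<le> 4 * Re (\<Phi> z) * Re a * (cmod (z + cnj a))\<^sup>2"
    unfolding power_mult_distrib half_plane_norm_diff by (simp add: algebra_simps)
  then have "(4 * Re a) * (Re z * (cmod (\<Phi> z + cnj a))\<^sup>2) \<le> (4 * Re a) * (Re (\<Phi> z) * (cmod (z + cnj a))\<^sup>2)"
    by (simp add: algebra_simps)
  then show ?thesis using a by (subst (asm) mult_le_cancel_left_neg) auto
qed

section \<open>Holomorphic maps of two variables along complex curves\<close>

text \<open>This brings in the one-variable theory: by the chain rule and complex linearity of the
  differential \<open>L\<close>, the composition has the complex derivative
  \<open>L (d1, d2)\<close>.\<close>

lemma holomorphic2_on_compose: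
  assumes G: "holomorphic2_on G U" and h: "h1 holomorphic_on S" "h2 holomorphic_on S" and "open S"
    and maps: "\<And>z. z \<in> S \<Longrightarrow> (h1 z, h2 z) \<in> U"
  shows "(\<lambda>z. fst (G (h1 z, h2 z))) holomorphic_on S"
    and "(\<lambda>z. snd (G (h1 z, h2 z))) holomorphic_on S"
proof -
  have "(\<lambda>z. fst (G (h1 z, h2 z))) field_differentiable at z within S \<and>
        (\<lambda>z. snd (G (h1 z, h2 z))) field_differentiable at z within S" if z: "z \<in> S" for z
  proof -
    obtain d1 d2 where d1: "(h1 has_field_derivative d1) (at z within S)"
      and d2: "(h2 has_field_derivative d2) (at z within S)"
      using h z unfolding holomorphic_on_def field_differentiable_def by meson
    have dh: "((\<lambda>z. (h1 z, h2 z)) has_derivative (\<lambda>c. (d1 * c, d2 * c))) (at z within S)"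
      using d1 d2 unfolding has_field_derivative_def by (rule has_derivative_Pair)
    obtain L where L: "(G has_derivative L) (at (h1 z, h2 z))"
      and lin: "\<And>c v. L (cscale c v) = cscale c (L v)"
      using G maps[OF z] unfolding holomorphic2_on_def by blast
    have "((\<lambda>z. G (h1 z, h2 z)) has_derivative (\<lambda>c. L (d1 * c, d2 * c))) (at z within S)"
      using has_derivative_compose[OF dh L] .
    also have "(\<lambda>c. L (d1 * c, d2 * c)) = (\<lambda>c. cscale c (L (d1, d2)))"
      by (simp add: lin[symmetric]) (simp add: cscale_def mult.commute)
    finally have dG: "((\<lambda>z. G (h1 z, h2 z)) has_derivative (\<lambda>c. cscale c (L (d1, d2)))) (at z within S)" .
    have "((\<lambda>z. fst (G (h1 z, h2 z))) has_field_derivative fst (L (d1, d2))) (at z within S)"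
      "((\<lambda>z. snd (G (h1 z, h2 z))) has_field_derivative snd (L (d1, d2))) (at z within S)"
      unfolding has_field_derivative_def
      by (rule has_derivative_eq_rhs[OF has_derivative_fst[OF dG]]
               has_derivative_eq_rhs[OF has_derivative_snd[OF dG]],
          simp add: cscale_def fun_eq_iff mult.commute)+
    then show ?thesis by (auto simp: field_differentiable_def)
  qed
  then show "(\<lambda>z. fst (G (h1 z, h2 z))) holomorphic_on S"
    and "(\<lambda>z. snd (G (h1 z, h2 z))) holomorphic_on S"
    by (auto simp: holomorphic_on_def)
qed

lemma holomorphic2_on_imp_continuous_on:
  "holomorphic2_on G U \<Longrightarrow> continuous_on U G"
  unfolding holomorphic2_on_def
  by (meson continuous_at_imp_continuous_on has_derivative_continuous)

lemma norm_cscale: "norm (cscale c v) = cmod c * norm v"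
  by (simp add: cscale_def norm_Pair norm_mult power_mult_distrib flip: distrib_left)
     (simp add: real_sqrt_mult norm_prod_def)

section \<open>Strict convexity and convergence to boundary points\<close>

text \<open>Otherwise a supporting functional attains its minimum over the closure at the midpoint.
  It must then take the same value at both ends, so the whole segment lies in a hyperplane that
  misses \<Omega>, hence in the frontier.\<close>

lemma strictly_geometrically_convex_midpoint:
  fixes \<Omega> :: "'a::euclidean_space set"
  assumes "open \<Omega>" and strict: "strictly_geometrically_convex \<Omega>"
    and ab: "a \<in> closure \<Omega>" "b \<in> closure \<Omega>" "a \<noteq> b"
  shows "midpoint a b \<in> \<Omega>"
proof (rule ccontr)
  assume nin: "midpoint a b \<notin> \<Omega>"
  have cvx: "convex \<Omega>" using strict by (simp add: strictly_geometrically_convex_def)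
  have seg: "closed_segment a b \<subseteq> closure \<Omega>"
    using ab cvx by (simp add: closed_segment_subset convex_closure)
  have "closed_segment a b \<subseteq> frontier \<Omega>"
  proof (cases "\<Omega> = {}")
    case False
    have ri: "rel_interior \<Omega> = \<Omega>" using \<open>open \<Omega>\<close> by (simp add: rel_interior_open)
    have mcl: "midpoint a b \<in> closure \<Omega>" using seg midpoint_in_closed_segment by blast
    obtain v where le: "\<And>y. y \<in> closure \<Omega> \<Longrightarrow> v \<bullet> midpoint a b \<le> v \<bullet> y"
      and less: "\<And>y. y \<in> \<Omega> \<Longrightarrow> v \<bullet> midpoint a b < v \<bullet> y"
      using supporting_hyperplane_relative_frontier[OF cvx mcl] nin unfolding ri by metis
    have "v \<bullet> midpoint a b = (v \<bullet> a + v \<bullet> b) / 2"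
      by (simp add: midpoint_def inner_add_right)
    then have eq: "v \<bullet> a = v \<bullet> midpoint a b" "v \<bullet> b = v \<bullet> midpoint a b"
      using le[OF ab(1)] le[OF ab(2)] by (simp_all add: field_simps)
    have "x \<notin> \<Omega>" if "x \<in> closed_segment a b" for x
    proof -
      obtain u where "x = (1 - u) *\<^sub>R a + u *\<^sub>R b"
        using \<open>x \<in> closed_segment a b\<close> by (auto simp: in_segment)
      then have "v \<bullet> x = (1 - u) * (v \<bullet> a) + u * (v \<bullet> b)"
        by (simp add: inner_add_right)
      then have "v \<bullet> x = v \<bullet> midpoint a b"
        unfolding eq by (simp add: algebra_simps)
      then show ?thesis using less by fastforce
    qed
    then show ?thesis
      using seg \<open>open \<Omega>\<close> by (auto simp: frontier_def interior_open)
  qed (use ab in auto)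
  then show False using strict ab by (auto simp: strictly_geometrically_convex_def)
qed

text \<open>By compactness the functional exceeds its value at \<open>b\<close> by a fixed gap on
  the part of \<open>K\<close> outside any ball about \<open>b\<close>.\<close>

lemma tendsto_exposed_point:
  fixes X :: "'i \<Rightarrow> 'a::euclidean_space"
  assumes K: "compact K" and X: "\<forall>\<^sub>F i in G. X i \<in> K"
    and exposed: "\<And>x. x \<in> K \<Longrightarrow> x \<noteq> b \<Longrightarrow> v \<bullet> b < v \<bullet> x"
    and lim: "((\<lambda>i. v \<bullet> X i) \<longlongrightarrow> v \<bullet> b) G"
  shows "(X \<longlongrightarrow> b) G"
proof (rule tendstoI)
  fix e :: real assume "e > 0"
  have cK: "compact (K - ball b e)" using K by (simp add: compact_diff)
  show "\<forall>\<^sub>F i in G. dist (X i) b < e"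
  proof (cases "K - ball b e = {}")
    case True
    show ?thesis using X by eventually_elim (use True in \<open>auto simp: dist_commute\<close>)
  next
    case False
    obtain c where c: "c \<in> K - ball b e" "\<And>x. x \<in> K - ball b e \<Longrightarrow> v \<bullet> c \<le> v \<bullet> x"
      using continuous_attains_inf[OF cK False, of "\<lambda>x. v \<bullet> x"] continuous_on_inner[OF continuous_on_const continuous_on_id] by blast
    have "v \<bullet> b < v \<bullet> c" using c(1) \<open>e > 0\<close> by (intro exposed) auto
    then have "\<forall>\<^sub>F i in G. v \<bullet> X i < v \<bullet> c" by (rule order_tendstoD(2)[OF lim])
    with X show ?thesis
    proof eventually_elim
      case (elim i)
      then have "X i \<in> ball b e" using c(2)[of "X i"] by force
      then show ?case by (simp add: dist_commute)
    qed
  qed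
qed

text \<open>Along complex lines the distance to a supporting hyperplane at \<open>b\<close> is a positive
  harmonic function, so by Harnack's inequality it tends to \<open>0\<close> at all points at once.\<close>

lemma tendsto_frontier_point_transfer:
  fixes h :: "'i \<Rightarrow> complex \<times> complex \<Rightarrow> complex \<times> complex"
  assumes "open \<Omega>" "bounded \<Omega>" and strict: "strictly_geometrically_convex \<Omega>"
    and b: "b \<in> frontier \<Omega>"
    and D: "open D" "connected D"
    and hol: "\<And>i. holomorphic2_on (h i) D" and maps: "\<And>i x. x \<in> D \<Longrightarrow> h i x \<in> \<Omega>"
    and p: "p \<in> D" and q: "q \<in> D" and lim: "((\<lambda>i. h i p) \<longlongrightarrow> b) G"
  shows "((\<lambda>i. h i q) \<longlongrightarrow> b) G"
proof -
  have cvx: "convex \<Omega>" using strict by (simp add: strictly_geometrically_convex_def)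
  have ri: "rel_interior \<Omega> = \<Omega>" using \<open>open \<Omega>\<close> by (simp add: rel_interior_open)
  have bcl: "b \<in> closure \<Omega>" "b \<notin> \<Omega>"
    using b \<open>open \<Omega>\<close> by (auto simp: frontier_def interior_open)
  obtain v where le: "\<And>y. y \<in> closure \<Omega> \<Longrightarrow> v \<bullet> b \<le> v \<bullet> y"
    and less: "\<And>y. y \<in> \<Omega> \<Longrightarrow> v \<bullet> b < v \<bullet> y"
    using supporting_hyperplane_relative_frontier[OF cvx bcl(1)] bcl(2) unfolding ri by metis
  \<comment> \<open>The midpoint of \<open>x\<close> and \<open>b\<close> lies in \<Omega>, where
    the functional is strictly larger than at \<open>b\<close>; hence so is its value at
    \<open>x\<close>.\<close>
  have exposed: "v \<bullet> b < v \<bullet> x" if "x \<in> closure \<Omega>" "x \<noteq> b" for x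
  proof -
    have "v \<bullet> b < v \<bullet> midpoint x b"
      using that bcl strict \<open>open \<Omega>\<close> by (intro less strictly_geometrically_convex_midpoint)
    then show ?thesis by (simp add: midpoint_def inner_add_right)
  qed
  show ?thesis
  \<comment> \<open>It suffices that convergence to \<open>b\<close> spreads within a small ball
    about each point; connectedness of \<open>D\<close> does the rest.\<close>
  proof (rule connected_induction_simple[OF D(2) p q, where P = "\<lambda>x. ((\<lambda>i. h i x) \<longlongrightarrow> b) G"])
    show "((\<lambda>i. h i p) \<longlongrightarrow> b) G" by fact
    fix a assume "a \<in> D"
    then obtain r where r: "r > 0" "ball a r \<subseteq> D" using D(1) open_contains_ball by blast
    have "((\<lambda>i. h i y) \<longlongrightarrow> b) G"
      if x: "x \<in> ball a (r/5)" and y: "y \<in> ball a (r/5)" and limx: "((\<lambda>i. h i x) \<longlongrightarrow> b) G" for x y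
    proof -
      \<comment> \<open>The complex line through \<open>x\<close> and \<open>y\<close> has
        \<open>x\<close> at parameter 0 and \<open>y\<close> at 1/2, the radius in
        \<open>Harnack_disc\<close>. Over the unit disc it stays within |\<open>a\<close> -
        \<open>x\<close>| + 2 |\<open>y\<close> - \<open>x\<close>| < r/5 + 4r/5 of
        \<open>a\<close>, which explains the radius \<open>r/5\<close>.\<close>
      define l1 l2 where "l1 z = fst x + z * (2 * (fst y - fst x))"
        and "l2 z = snd x + z * (2 * (snd y - snd x))" for z :: complex
      have l: "(l1 z, l2 z) = x + cscale (2 * z) (y - x)" for z
        by (simp add: l1_def l2_def cscale_def prod_eq_iff)
      have inD: "(l1 z, l2 z) \<in> D" if "z \<in> ball 0 1" for z
      proof -
        have "dist a (l1 z, l2 z) \<le> dist a x + 2 * cmod z * dist y x"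
          using dist_triangle[of a "(l1 z, l2 z)" x] unfolding l
          by (simp add: norm_cscale dist_norm norm_mult)
        also have "\<dots> \<le> dist a x + 2 * 1 * dist y x"
          using that by (intro add_left_mono mult_right_mono) auto
        also have "\<dots> < r"
          using x y dist_triangle[of y x a] by (simp add: dist_commute)
        finally show ?thesis using r by auto
      qed
      \<comment> \<open>Conjugating the coordinates of \<open>v\<close> makes the real inner product
        with \<open>v\<close> the real part of a holomorphic function.\<close>
      define F where "F i z = cnj (fst v) * fst (h i (l1 z, l2 z))
          + cnj (snd v) * snd (h i (l1 z, l2 z)) - of_real (v \<bullet> b)" for i z
      have ReF: "Re (F i z) = v \<bullet> h i (l1 z, l2 z) - v \<bullet> b" for i z
        by (simp add: F_def inner_prod_def inner_complex_def)
      have holF: "F i holomorphic_on ball 0 1" for i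
        unfolding F_def using inD
        by (intro holomorphic_intros holomorphic2_on_compose[OF hol])
           (auto simp: l1_def l2_def intro!: holomorphic_intros)
      have "Re (F i (1/2)) \<le> 6 * Re (F i 0)" for i
        using holF inD maps less by (intro Harnack_disc) (auto simp: ReF)
      moreover have "(l1 (1/2), l2 (1/2)) = y" "(l1 0, l2 0) = x"
        by (auto simp: l1_def l2_def prod_eq_iff field_simps)
      ultimately have harnack: "v \<bullet> h i y - v \<bullet> b \<le> 6 * (v \<bullet> h i x - v \<bullet> b)" for i
        by (metis ReF)
      have xyD: "x \<in> D" "y \<in> D" using x y r by auto
      have "((\<lambda>i. v \<bullet> h i x) \<longlongrightarrow> v \<bullet> b) G"
        using limx by (intro tendsto_intros)
      then have "((\<lambda>i. 6 * (v \<bullet> h i x - v \<bullet> b)) \<longlongrightarrow> 6 * (v \<bullet> b - v \<bullet> b)) G"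
        by (intro tendsto_mult tendsto_diff tendsto_const)
      then have upper: "((\<lambda>i. 6 * (v \<bullet> h i x - v \<bullet> b)) \<longlongrightarrow> 0) G" by simp
      have "((\<lambda>i. v \<bullet> h i y - v \<bullet> b) \<longlongrightarrow> 0) G"
      proof (rule tendsto_sandwich[OF _ _ tendsto_const upper])
        show "\<forall>\<^sub>F i in G. 0 \<le> v \<bullet> h i y - v \<bullet> b"
          using less[OF maps[OF xyD(2)]] by (simp add: less_imp_le)
        show "\<forall>\<^sub>F i in G. v \<bullet> h i y - v \<bullet> b \<le> 6 * (v \<bullet> h i x - v \<bullet> b)"
          by (intro always_eventually allI harnack)
      qed
      then have "((\<lambda>i. v \<bullet> h i y) \<longlongrightarrow> v \<bullet> b) G"
        unfolding Lim_null[of _ "v \<bullet> b"] .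
      then show ?thesis
        using exposed subsetD[OF closure_subset maps[OF xyD(2)]] \<open>bounded \<Omega>\<close>
        by (intro tendsto_exposed_point[of "closure \<Omega>" _ _ b v]) (auto intro!: always_eventually)
    qed
    note near = this
    have sub: "ball a (r/5) \<subseteq> D"
      using r subset_ball[of "r/5" r a] by auto
    show "\<exists>T. openin (top_of_set D) T \<and> a \<in> T \<and>
        (\<forall>x\<in>T. \<forall>y\<in>T. ((\<lambda>i. h i x) \<longlongrightarrow> b) G \<longrightarrow> ((\<lambda>i. h i y) \<longlongrightarrow> b) G)"
    proof (intro exI conjI ballI impI)
      show "openin (top_of_set D) (ball a (r/5))" using sub by (simp add: open_subset)
      show "a \<in> ball a (r/5)" using r by simp
    qed (rule near)
  qed
qed

section \<open>A Julia-type estimate through midpoints\<close>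

lemma midpoint_interior_closure:
  fixes S :: "'a::euclidean_space set"
  assumes "convex S" "open S" "x \<in> S" "y \<in> closure S"
  shows "midpoint x y \<in> S"
proof (cases "x = y")
  case False
  have "open_segment x y \<subseteq> S"
    using in_interior_closure_convex_segment[of S x y] assms by (simp add: interior_open)
  then show ?thesis using False by auto
qed (use assms in auto)

text \<open>A form of Julia's lemma: the map \<open>z \<mapsto> fst (\<psi> (midpoint (f (z, 0)) w))\<close> with
  \<open>w = f (\<zeta>, 0)\<close> fixes \<open>\<zeta>\<close>, so it preserves the discs about \<open>\<zeta>\<close>. As \<open>\<zeta>\<close> runs to infinity
  along a vertical line, these discs turn into half-planes.\<close>

lemma Re_inverse_midpoint_le:
  assumes \<Omega>: "open \<Omega>" "convex \<Omega>"
    and f: "holomorphic2_on f D" "\<And>x. x \<in> D \<Longrightarrow> f x \<in> \<Omega>"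
    and \<psi>: "holomorphic2_on \<psi> \<Omega>" "\<And>y. y \<in> \<Omega> \<Longrightarrow> \<psi> y \<in> D" "\<And>x. x \<in> D \<Longrightarrow> \<psi> (f x) = x"
    and neg: "\<And>x. x \<in> D \<Longrightarrow> Re (fst x) < 0" and slice: "\<And>z. Re z < 0 \<Longrightarrow> (z, 0) \<in> D"
    and \<zeta>: "\<And>n. Re (\<zeta> n) = c" "c < 0" "filterlim \<zeta> at_infinity sequentially"
    and a: "(\<lambda>n. f (\<zeta> n, 0)) \<longlonglongrightarrow> a"
    and z: "Re z < 0"
  shows "Re (fst (\<psi> (midpoint (f (z, 0)) a))) \<le> Re z"
proof -
  define H where "H = {z. Re z < 0}"
  define m where "m w z = midpoint (f (z, 0)) w" for w and z :: complex
  define \<Phi> where "\<Phi> n z = fst (\<psi> (m (f (\<zeta> n, 0)) z))" for n z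
  have \<zeta>D: "(\<zeta> n, 0) \<in> D" for n using slice \<zeta> by auto
  have acl: "a \<in> closure \<Omega>"
    using a f(2)[OF \<zeta>D] unfolding closure_sequential by (intro exI[of _ "\<lambda>n. f (\<zeta> n, 0)"]) simp
  have m_in: "m w z \<in> \<Omega>" if "w \<in> closure \<Omega>" "z \<in> H" for w z
    unfolding m_def using that \<Omega> f(2) slice by (intro midpoint_interior_closure) (auto simp: H_def)
  have wcl: "f (\<zeta> n, 0) \<in> closure \<Omega>" for n
    using f(2)[OF \<zeta>D] closure_subset by blast
  have \<Phi>H: "\<Phi> n z \<in> H" if "z \<in> H" for n z
    using neg[OF \<psi>(2)[OF m_in[OF wcl[of n] that]]] by (simp add: H_def \<Phi>_def)
  have \<Phi>hol: "\<Phi> n holomorphic_on H" for n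
  proof -
    define w where "w = f (\<zeta> n, 0)"
    have oH: "open H" unfolding H_def by (rule open_halfspace_Re_lt)
    have m_eq: "m w z = ((fst (f (z, 0)) + fst w) / 2, (snd (f (z, 0)) + snd w) / 2)" for z
      by (simp add: m_def midpoint_def prod_eq_iff scaleR_conv_of_real)
    have "(\<lambda>z. fst (\<psi> ((fst (f (z, 0)) + fst w) / 2, (snd (f (z, 0)) + snd w) / 2))) holomorphic_on H"
      using slice m_in[OF wcl[of n]] oH unfolding w_def[symmetric] m_eq
      by (intro holomorphic2_on_compose[OF \<psi>(1)] holomorphic_intros holomorphic2_on_compose[OF f(1)])
         (auto simp: H_def)
    then show ?thesis unfolding \<Phi>_def w_def[symmetric] m_eq .
  qed
  have fixed: "\<Phi> n (\<zeta> n) = \<zeta> n" for n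
    using \<psi>(3)[OF \<zeta>D] by (simp add: \<Phi>_def m_def)
  \<comment> \<open>Dividing the Schwarz-Pick inequality at the fixed point \<zeta> n by the squared
    modulus of \<open>s n\<close> gives a form in which both squared factors tend to 1.\<close>
  define s where "s n = cnj (\<zeta> n)" for n
  have "Re (s n) < 0" for n using \<zeta>(1)[of n] \<zeta>(2) by (simp add: s_def)
  then have s0: "s n \<noteq> 0" for n by (metis less_irrefl zero_complex.simps(1))
  have ineq: "Re (\<Phi> n z) * (cmod (1 + z / s n))\<^sup>2 \<le> Re z * (cmod (1 + \<Phi> n z / s n))\<^sup>2" for n
  proof -
    have "Re (\<Phi> n z) * (cmod (z + s n))\<^sup>2 \<le> Re z * (cmod (\<Phi> n z + s n))\<^sup>2"
      unfolding s_def using \<Phi>hol \<Phi>H fixed z \<zeta>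
      by (intro Schwarz_Pick_fixed_point) (auto simp: H_def)
    moreover have "(cmod (u + s n))\<^sup>2 = (cmod (1 + u / s n))\<^sup>2 * (cmod (s n))\<^sup>2" for u
    proof -
      have "u + s n = (1 + u / s n) * s n" using s0 by (simp add: field_simps)
      then show ?thesis by (metis norm_mult power_mult_distrib)
    qed
    ultimately have "(Re (\<Phi> n z) * (cmod (1 + z / s n))\<^sup>2) * (cmod (s n))\<^sup>2
        \<le> (Re z * (cmod (1 + \<Phi> n z / s n))\<^sup>2) * (cmod (s n))\<^sup>2"
      by (simp add: mult.assoc)
    then show ?thesis using s0 by (simp add: mult_le_cancel_right)
  qed
  have zH: "z \<in> H" using z by (simp add: H_def)
  define l where "l = fst (\<psi> (m a z))"
  \<comment> \<open>The limiting midpoint \<open>m a z\<close> is still interior, because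
    \<open>f (z, 0)\<close> is; thus \<psi> is continuous there and the values \<Phi> n z converge,
    hence stay bounded.\<close>
  have lim: "(\<lambda>n. \<Phi> n z) \<longlonglongrightarrow> l"
  proof -
    have "isCont \<psi> (m a z)"
      using holomorphic2_on_imp_continuous_on[OF \<psi>(1)] \<Omega>(1) m_in[OF acl zH]
      by (simp add: continuous_on_eq_continuous_at)
    moreover have "(\<lambda>n. m (f (\<zeta> n, 0)) z) \<longlonglongrightarrow> m a z"
      unfolding m_def midpoint_def using a by (intro tendsto_intros)
    ultimately show ?thesis
      unfolding \<Phi>_def l_def by (intro tendsto_fst isCont_tendsto_compose[of _ \<psi>])
  qed
  have "filterlim s at_infinity sequentially"
    using \<zeta>(3) unfolding s_def filterlim_at_infinity_conv_norm_at_top by simp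
  note null = tendsto_divide_0[OF tendsto_const this] tendsto_divide_0[OF lim this]
  have "Re l * (cmod (1 + 0))\<^sup>2 \<le> Re z * (cmod (1 + 0))\<^sup>2"
  proof (rule LIMSEQ_le)
    show "(\<lambda>n. Re (\<Phi> n z) * (cmod (1 + z / s n))\<^sup>2) \<longlonglongrightarrow> Re l * (cmod (1 + 0))\<^sup>2"
      by (intro tendsto_intros lim null)
    show "(\<lambda>n. Re z * (cmod (1 + \<Phi> n z / s n))\<^sup>2) \<longlonglongrightarrow> Re z * (cmod (1 + 0))\<^sup>2"
      by (intro tendsto_intros lim null)
  qed (use ineq in auto)
  then show ?thesis by (simp add: l_def m_def)
qed

section \<open>Vertical translations and the common limit\<close>

theorem theorem1:
  fixes \<Omega> D :: "(complex \<times> complex) set"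
    and \<sigma> :: "complex \<Rightarrow> real"
    and \<psi> :: "complex \<times> complex \<Rightarrow> complex \<times> complex"
  assumes "is_domain \<Omega>" and "bounded \<Omega>" and "C1_boundary \<Omega>"
    and "strictly_geometrically_convex \<Omega>"
    and "C1_on \<sigma> UNIV" and "\<And>z. 0 \<le> \<sigma> z" and "\<sigma> 0 = 0"
    and "D = {(w, z). Re w + \<sigma> z < 0}"
    and "biholomorphism \<psi> \<Omega> D"
  shows "\<exists>a\<in>frontier \<Omega>. \<forall>(w, z)\<in>D.
           ((\<lambda>t::real. inv_into \<Omega> \<psi> (w + \<i> * of_real t, z)) \<longlongrightarrow> a) at_top \<and>
           ((\<lambda>t::real. inv_into \<Omega> \<psi> (w - \<i> * of_real t, z)) \<longlongrightarrow> a) at_top"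
proof -
  define f where "f = inv_into \<Omega> \<psi>"
  \<comment> \<open>Membership in \<open>D\<close> depends on the first coordinate only through its
    real part, so every \<open>T t\<close> preserves \<open>D\<close>; negative \<open>t\<close>
    covers the other sign in the claim.\<close>
  define T where "T t p = (fst p + \<i> * of_real t, snd p)" for t :: real and p :: "complex \<times> complex"
  have \<Omega>: "open \<Omega>" "connected \<Omega>" "convex \<Omega>"
    using assms(1,4) by (auto simp: is_domain_def strictly_geometrically_convex_def)
  have bij: "bij_betw \<psi> \<Omega> D" and hol\<psi>: "holomorphic2_on \<psi> \<Omega>" and holf: "holomorphic2_on f D"
    using assms(9) by (auto simp: biholomorphism_def f_def)
  have fD: "f x \<in> \<Omega>" "\<psi> (f x) = x" if "x \<in> D" for x
    using bij that unfolding f_def bij_betw_def by (auto intro: inv_into_into f_inv_into_f)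
  have \<psi>D: "\<psi> y \<in> D" if "y \<in> \<Omega>" for y
    using bij that by (auto simp: bij_betw_def)
  have cont\<psi>: "continuous_on \<Omega> \<psi>" by (rule holomorphic2_on_imp_continuous_on[OF hol\<psi>])
  have "connected D"
    using connected_continuous_image[OF cont\<psi> \<Omega>(2)] bij by (simp add: bij_betw_def)
  have "continuous_on UNIV \<sigma>"
    using assms(5) unfolding C1_on_def
    by (meson continuous_at_imp_continuous_on has_derivative_continuous)
  then have "open {x. Re (fst x) + \<sigma> (snd x) < 0}"
    by (intro open_Collect_less continuous_intros continuous_on_compose2[of UNIV \<sigma> UNIV snd]) auto
  then have "open D"
    by (simp add: assms(8) case_prod_unfold)
  have neg: "Re (fst x) < 0" if "x \<in> D" for x
    using that assms(6)[of "snd x"] by (auto simp: assms(8))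
  have slice: "(z, 0) \<in> D" if "Re z < 0" for z
    using that by (simp add: assms(7,8))
  have TD: "T t x \<in> D" if "x \<in> D" for t x
    using that by (auto simp: T_def assms(8))
  have holT: "holomorphic2_on (\<lambda>x. f (T t x)) D" for t
    unfolding holomorphic2_on_def
  proof
    fix x assume "x \<in> D"
    then obtain L where L: "(f has_derivative L) (at (T t x))" "\<And>c v. L (cscale c v) = cscale c (L v)"
      using holf TD unfolding holomorphic2_on_def by blast
    have "(T t has_derivative (\<lambda>v. (fst v + 0, snd v))) (at x)"
      unfolding T_def by (intro derivative_intros)
    from has_derivative_compose[OF this L(1)]
    show "\<exists>L. ((\<lambda>x. f (T t x)) has_derivative L) (at x) \<and> (\<forall>c v. L (cscale c v) = cscale c (L v))"
      using L(2) by auto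
  qed
  define p :: "complex \<times> complex" where "p = (-1, 0)"
  define \<zeta> where "\<zeta> t = -1 + \<i> * of_real t" for t :: real
  have pD: "p \<in> D" using slice by (simp add: p_def)
  have Tp: "T t p = (\<zeta> t, 0)" for t by (simp add: T_def p_def \<zeta>_def)
  have \<zeta>_infinity: "filterlim (\<lambda>n. \<zeta> (t n)) at_infinity F"
    if "filterlim t at_infinity F" for t and F :: "nat filter"
  proof -
    have "filterlim (\<lambda>n. \<bar>t n\<bar>) at_top F"
      using that unfolding filterlim_at_infinity_conv_norm_at_top by simp
    moreover have "\<bar>t n\<bar> \<le> norm (\<zeta> (t n))" for n
      using abs_Im_le_cmod[of "\<zeta> (t n)"] by (simp add: \<zeta>_def)
    ultimately have "filterlim (\<lambda>n. norm (\<zeta> (t n))) at_top F"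
      by (auto intro: filterlim_at_top_mono always_eventually)
    then show ?thesis unfolding filterlim_at_infinity_conv_norm_at_top .
  qed
  \<comment> \<open>A limit inside \<Omega> would, by continuity of \<psi>, force the unbounded
    points \<zeta> (t n) to converge.\<close>
  have limit_frontier: "a \<in> frontier \<Omega>"
    if t: "filterlim t at_infinity sequentially" and a: "(\<lambda>n. f (T (t n) p)) \<longlonglongrightarrow> a" for t a
  proof -
    have acl: "a \<in> closure \<Omega>"
      using a fD(1)[OF TD[OF pD]] unfolding closure_sequential
      by (intro exI[of _ "\<lambda>n. f (T (t n) p)"]) simp
    have "a \<notin> \<Omega>"
    proof
      assume "a \<in> \<Omega>"
      then have "isCont \<psi> a"
        using cont\<psi> \<Omega>(1) by (simp add: continuous_on_eq_continuous_at)
      then have "(\<lambda>n. fst (\<psi> (f (T (t n) p)))) \<longlonglongrightarrow> fst (\<psi> a)"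
        using a by (intro tendsto_fst isCont_tendsto_compose[of _ \<psi>])
      then have "(\<lambda>n. \<zeta> (t n)) \<longlonglongrightarrow> fst (\<psi> a)"
        by (simp add: fD(2)[OF TD[OF pD]]) (simp add: Tp)
      with \<zeta>_infinity[OF t] show False
        using not_tendsto_and_filterlim_at_infinity[OF sequentially_bot] by blast
    qed
    with acl show ?thesis by (auto simp: frontier_def interior_open \<Omega>)
  qed
  have transfer: "((\<lambda>i. f (T (t i) y)) \<longlongrightarrow> b) F"
    if "b \<in> frontier \<Omega>" "((\<lambda>i. f (T (t i) x)) \<longlongrightarrow> b) F" "x \<in> D" "y \<in> D"
    for t :: "'i \<Rightarrow> real" and b x y F
    by (rule tendsto_frontier_point_transfer[where \<Omega> = \<Omega> and D = D and p = x])
       (use that assms \<Omega> \<open>open D\<close> \<open>connected D\<close> holT TD fD in auto)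
  have unique: "a = b"
    if t: "filterlim t at_infinity sequentially" "(\<lambda>n. f (T (t n) p)) \<longlonglongrightarrow> a"
      and s: "filterlim s at_infinity sequentially" "(\<lambda>n. f (T (s n) p)) \<longlonglongrightarrow> b" for t s a b
  proof (rule ccontr)
    assume "a \<noteq> b"
    have a: "a \<in> frontier \<Omega>" and b: "b \<in> frontier \<Omega>"
      using limit_frontier t s by auto
    have "midpoint b a \<in> \<Omega>"
      using strictly_geometrically_convex_midpoint[OF \<Omega>(1) assms(4), of b a] a b \<open>a \<noteq> b\<close>
      by (auto simp: frontier_def)
    then have cont: "isCont \<psi> (midpoint b a)"
      using cont\<psi> \<Omega>(1) by (simp add: continuous_on_eq_continuous_at)
    have "Re (fst (\<psi> (midpoint b a))) \<le> - u" if "u > 0" for u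
    proof (rule LIMSEQ_le_const2)
      have "(\<lambda>n. f (T (s n) (of_real (- u), 0))) \<longlonglongrightarrow> b"
        using transfer[OF b s(2) pD] slice that by simp
      then have "(\<lambda>n. midpoint (f (T (s n) (of_real (- u), 0))) a) \<longlonglongrightarrow> midpoint b a"
        unfolding midpoint_def by (intro tendsto_intros)
      then show "(\<lambda>n. Re (fst (\<psi> (midpoint (f (T (s n) (of_real (- u), 0))) a))))
          \<longlonglongrightarrow> Re (fst (\<psi> (midpoint b a)))"
        using cont by (intro tendsto_Re tendsto_fst isCont_tendsto_compose[of _ \<psi>])
      have "Re (fst (\<psi> (midpoint (f (z, 0)) a))) \<le> Re z" if "Re z < 0" for z
        using \<zeta>_infinity[OF t(1)] t(2) that
        by (intro Re_inverse_midpoint_le[where \<Omega> = \<Omega> and D = D and c = "-1" and \<zeta> = "\<lambda>n. \<zeta> (t n)"])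
           (use \<Omega> holf hol\<psi> fD \<psi>D neg slice in \<open>auto simp: Tp \<zeta>_def\<close>)
      from this[of "of_real (- u) + \<i> * of_real (s _)"]
      show "\<exists>N. \<forall>n\<ge>N. Re (fst (\<psi> (midpoint (f (T (s n) (of_real (- u), 0))) a))) \<le> - u"
        using that by (auto simp: T_def)
    qed
    \<comment> \<open>This \<open>u\<close> is positive and exceeds the modulus of the left-hand
      side.\<close>
    from this[of "1 + \<bar>Re (fst (\<psi> (midpoint b a)))\<bar>"] show False by linarith
  qed
  have subseq: "\<exists>a r. strict_mono r \<and> (\<lambda>n. f (T (t (r n)) p)) \<longlonglongrightarrow> a" for t :: "nat \<Rightarrow> real"
  proof -
    have "\<forall>n. f (T (t n) p) \<in> closure \<Omega>" using fD(1)[OF TD[OF pD]] closure_subset by blast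
    moreover have "seq_compact (closure \<Omega>)"
      using assms(2) by (simp add: compact_imp_seq_compact)
    ultimately show ?thesis by (force simp: o_def elim: seq_compactE)
  qed
  have real_infinity: "filterlim t at_infinity sequentially"
    if "\<And>n. real n \<le> \<bar>t n\<bar>" for t
    unfolding filterlim_at_infinity_conv_norm_at_top using that
    by (intro filterlim_at_top_mono[OF filterlim_real_sequentially]) auto
  obtain a r where r: "strict_mono r" and a: "(\<lambda>n. f (T (real (r n)) p)) \<longlonglongrightarrow> a"
    using subseq[of real] by blast
  have r_inf: "filterlim (\<lambda>n. real (r n)) at_infinity sequentially"
    using seq_suble[OF r] by (intro real_infinity) auto
  have afr: "a \<in> frontier \<Omega>" using limit_frontier[OF r_inf a] .
  \<comment> \<open>On the reals \<open>at_infinity\<close> contains both ends. If convergence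
    failed, times with |\<open>t n\<close>| \<ge> \<open>n\<close> would keep the images at distance
    at least \<open>e\<close> from \<open>a\<close>; a convergent subsequence, whose limit must be
    \<open>a\<close> by \<open>unique\<close>, contradicts this.\<close>
  have main: "((\<lambda>t. f (T t p)) \<longlongrightarrow> a) at_infinity"
  proof (rule ccontr)
    assume "\<not> ?thesis"
    then obtain e where "e > 0" and "\<not> (\<forall>\<^sub>F t in at_infinity. dist (f (T t p)) a < e)"
      by (auto simp: tendsto_iff)
    then have "\<forall>n. \<exists>t. real n \<le> \<bar>t\<bar> \<and> e \<le> dist (f (T t p)) a"
      by (simp add: eventually_at_infinity not_less)
    then obtain t where t: "\<And>n. real n \<le> \<bar>t n\<bar>" "\<And>n. e \<le> dist (f (T (t n) p)) a" by metis
    obtain b q where q: "strict_mono q" and b: "(\<lambda>n. f (T (t (q n)) p)) \<longlonglongrightarrow> b"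
      using subseq[of t] by blast
    have "real n \<le> \<bar>t (q n)\<bar>" for n
      using t(1)[of "q n"] seq_suble[OF q, of n] by linarith
    then have "a = b" by (intro unique[OF r_inf a _ b] real_infinity)
    then have "\<forall>\<^sub>F n in sequentially. dist (f (T (t (q n)) p)) a < e"
      using b \<open>e > 0\<close> by (auto dest: tendstoD)
    then show False using t(2) by (auto simp: not_less[symmetric] eventually_sequentially)
  qed
  \<comment> \<open>Taking \<open>g\<close> to be the identity or negation gives the two directions
    with the same \<open>a\<close>.\<close>
  have lim: "((\<lambda>t. f (T (g t) x)) \<longlongrightarrow> a) at_top"
    if "x \<in> D" "filterlim g at_infinity at_top" for x and g :: "real \<Rightarrow> real"
    by (rule transfer[OF afr filterlim_compose[OF main that(2)] pD that(1)])
  have "filterlim (\<lambda>t::real. t) at_infinity at_top" "filterlim (\<lambda>t::real. - t) at_infinity at_top"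
    by (auto simp: filterlim_at_infinity_conv_norm_at_top filterlim_abs_real)
  then show ?thesis
    using lim afr by (fastforce simp: T_def f_def)
qed

end
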